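(* Let $m\geq1$ and $g(t)=\sum_{j=1}^ma_{2j}t^{2j}\in\mathbb C[t]$ with $a_{2m}\neq0$. Then $$T_3(g)=T_3(g)^{\mathrm{ev}}\oplus T_3(g)^{\mathrm{odd}}$$ (as $\mathfrak{sl}(2)$-modules), where $T_3(g)^{\mathrm{ev}}:=\mathbb C[t]_{\mathrm{ev}}e^g$ and $T_3(g)^{\mathrm{odd}}:=\mathbb C[t]_{\mathrm{odd}}e^g$. Moreover, $$T_3(g)^{\mathrm{ev}}\simeq M\big(\tfrac14,(0,-1,m-1),K_3\big),\qquad T_3(g)^{\mathrm{odd}}\simeq M\big(\tfrac14,(0,1,m-1),K_3\big),$$ where $$K_3=\begin{pmatrix}-2a_2&-2&0&\cdots&0\\-4a_4&0&-2&\cdots&0\\\vdots&\vdots&\ddots&\ddots&\vdots\\-2(m-1)a_{2(m-1)}&0&\cdots&0&-2\\-2ma_{2m}&0&\cdots&0&0\end{pmatrix}\in\mathrm{GL}_m(\mathbb C)$$ (for $m=1$, $K_3=(-2a_2)$).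
   Context: The Lie algebra $\mathfrak{sl}(2)$ over $\mathbb C$ has basis $e,f,h$ with $[h,e]=e$, $[h,f]=-f$, $[e,f]=2h$; $\mathfrak h=\mathbb Ch$. The automorphism $\sigma$ of $\mathbb C[h]$ is $\sigma(g(h))=g(h-1)$, applied entrywise. For $E,F\in\mathrm{Mat}_n(\mathbb C[h])$ with $E\sigma(F)-F\sigma^{-1}(E)=2h\,\mathrm I_n$, $M(E,F)$ is the $\mathfrak{sl}(2)$-module on $\mathbb C[h]^{\oplus n}$ with $h$ acting by multiplication, $e\cdot\boldsymbol g=E\sigma(\boldsymbol g)$, $f\cdot\boldsymbol g=F\sigma^{-1}(\boldsymbol g)$. Put $\lambda_\alpha(h)=-(h-\alpha+1)(h+\alpha)$. For $\boldsymbol a=(a_-,a_0,a_+)\in\mathbb Z_{\geq0}\times\mathbb Z\times\mathbb Z_{\geq0}$ with $a_-+|a_0|+a_+=n$, $P_{(\boldsymbol a,\alpha)}(h)$ is the diagonal $n\times n$ matrix with diagonal entries: $1$ ($a_-$ times), then $|a_0|$ entries equal to $h-\alpha+1$ if $a_0\geq0$ and to $h+\alpha$ if $a_0<0$, then $(h-\alpha+1)(h+\alpha)$ ($a_+$ times); $\overline P_{(\boldsymbol a,\alpha)}(h)$ is the diagonal matrix with $\overline P_{(\boldsymbol a,\alpha)}P_{(\boldsymbol a,\alpha)}=\lambda_\alpha(h)\mathrm I_n$. For $K(h)\in\mathrm{GL}_n(\mathbb C[h])$ set $M(\alpha,\boldsymbol a,K(h)):=M\big(\sigma(K^{-1}(h)\overline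 P_{(\boldsymbol a,\alpha)}(h)),P_{(\boldsymbol a,\alpha)}(h)K(h)\big)$. $T_3(g)$ denotes $\mathbb C[t]e^g$ (with $\partial=d/dt$ acting by $\partial(pe^g)=(p'+pg')e^g$) as an $\mathfrak{sl}(2)$-module via $e\mapsto\tfrac12t^2$, $f\mapsto-\tfrac12\partial^2$, $h\mapsto\tfrac12t\partial+\tfrac14$. $\mathbb C[t]_{\mathrm{ev}}=\mathrm{Span}\{t^{2k}:k\geq0\}$ and $\mathbb C[t]_{\mathrm{odd}}=\mathrm{Span}\{t^{2k+1}:k\geq0\}$. *)

theory Defs
  imports
    "Jordan_Normal_Form.VS_Connect"
    "HOL-Library.Product_Plus"
    "HOL-Computational_Algebra.Polynomial"
begin

section \<open>The Lie algebra and its modules\<close>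

text \<open>The triple \<open>(x, y, z)\<close> stands for \<open>x e + y f + z h\<close>, and the bracket is the bilinear
  alternating extension of \<open>[h,e] = e\<close>, \<open>[h,f] = -f\<close>, \<open>[e,f] = 2h\<close>.\<close>

type_synonym sl2 = "complex \<times> complex \<times> complex"

definition sl2_e :: sl2 where "sl2_e = (1, 0, 0)"
definition sl2_f :: sl2 where "sl2_f = (0, 1, 0)"
definition sl2_h :: sl2 where "sl2_h = (0, 0, 1)"

fun sl2_scale :: "complex \<Rightarrow> sl2 \<Rightarrow> sl2" where
  "sl2_scale c (x, y, z) = (c * x, c * y, c * z)"

fun sl2_bracket :: "sl2 \<Rightarrow> sl2 \<Rightarrow> sl2" where
  "sl2_bracket (x, y, z) (x', y', z') = (z * x' - x * z', y * z' - z * y', 2 * (x * y' - y * x'))"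

lemma sl2_bracket_basis:
  "sl2_bracket sl2_h sl2_e = sl2_e"
  "sl2_bracket sl2_h sl2_f = - sl2_f"
  "sl2_bracket sl2_e sl2_f = sl2_scale 2 sl2_h"
  by (simp_all add: sl2_e_def sl2_f_def sl2_h_def uminus_prod_def)

lemma sl2_bracket_alternating: "sl2_bracket u u = 0"
  by (cases u) (simp add: zero_prod_def)

lemma sl2_bracket_bilinear:
  "sl2_bracket (u + v) w = sl2_bracket u w + sl2_bracket v w"
  "sl2_bracket u (v + w) = sl2_bracket u v + sl2_bracket u w"
  "sl2_bracket (sl2_scale c u) v = sl2_scale c (sl2_bracket u v)"
  "sl2_bracket u (sl2_scale c v) = sl2_scale c (sl2_bracket u v)"
  by (cases u; cases v; cases w; simp add: algebra_simps)+

record 'v sl2_mod = "(complex, 'v) module" +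
  act :: "sl2 \<Rightarrow> 'v \<Rightarrow> 'v"

locale sl2_module = vectorspace "class_ring :: complex ring" V
  for V :: "('v, 'x) sl2_mod_scheme" (structure) +
  assumes act_closed: "v \<in> carrier V \<Longrightarrow> act V u v \<in> carrier V"
    and act_add: "\<lbrakk>v \<in> carrier V; w \<in> carrier V\<rbrakk> \<Longrightarrow> act V u (v \<oplus> w) = act V u v \<oplus> act V u w"
    and act_smult: "v \<in> carrier V \<Longrightarrow> act V u (c \<odot>\<^bsub>V\<^esub> v) = c \<odot>\<^bsub>V\<^esub> act V u v"
    and add_act: "v \<in> carrier V \<Longrightarrow> act V (u + u') v = act V u v \<oplus> act V u' v"
    and scale_act: "v \<in> carrier V \<Longrightarrow> act V (sl2_scale c u) v = c \<odot>\<^bsub>V\<^esub> act V u v"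
    and bracket_act: "v \<in> carrier V \<Longrightarrow>
      act V (sl2_bracket u u') v = act V u (act V u' v) \<ominus> act V u' (act V u v)"

definition sl2_isomorphic :: "'v sl2_mod \<Rightarrow> 'w sl2_mod \<Rightarrow> bool" where
  "sl2_isomorphic V W \<longleftrightarrow> sl2_module V \<and> sl2_module W \<and>
    (\<exists>\<phi>. linear_map (class_ring :: complex ring) V W \<phi> \<and>
         bij_betw \<phi> (carrier V) (carrier W) \<and>
         (\<forall>u. \<forall>v \<in> carrier V. \<phi> (act V u v) = act W u (\<phi> v)))"

definition sl2_submodule :: "'v sl2_mod \<Rightarrow> 'v set \<Rightarrow> bool" where
  "sl2_submodule V W \<longleftrightarrow> sl2_module V \<and> VectorSpace.subspace (class_ring :: complex ring) W V \<and>
    (\<forall>u. \<forall>w \<in> W. act V u w \<in> W)"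

definition sl2_direct_sum :: "'v sl2_mod \<Rightarrow> 'v set \<Rightarrow> 'v set \<Rightarrow> bool" where
  "sl2_direct_sum V W1 W2 \<longleftrightarrow> sl2_submodule V W1 \<and> sl2_submodule V W2 \<and>
    LinearCombinations.module.submodule_sum V W1 W2 = carrier V \<and> W1 \<inter> W2 = {\<zero>\<^bsub>V\<^esub>}"

text \<open>The linear extension to the whole Lie algebra of given operators for \<open>e\<close>, \<open>f\<close>, \<open>h\<close>.\<close>

definition sl2_extend ::
  "(complex, 'v) module \<Rightarrow> ('v \<Rightarrow> 'v) \<Rightarrow> ('v \<Rightarrow> 'v) \<Rightarrow> ('v \<Rightarrow> 'v) \<Rightarrow> 'v sl2_mod" where
  "sl2_extend V e f h = module.extend V \<lparr>act =
     (\<lambda>(x, y, z) v. x \<odot>\<^bsub>V\<^esub> e v \<oplus>\<^bsub>V\<^esub> y \<odot>\<^bsub>V\<^esub> f v \<oplus>\<^bsub>V\<^esub> z \<odot>\<^bsub>V\<^esub> h v)\<rparr>"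


section \<open>The modules \<open>M(E,F)\<close> and \<open>M(\<alpha>,a,K)\<close>\<close>

definition sigma :: "complex poly \<Rightarrow> complex poly" where
  "sigma p = pcompose p [:-1, 1:]"

definition sigma_inv :: "complex poly \<Rightarrow> complex poly" where
  "sigma_inv p = pcompose p [:1, 1:]"

lemma sigma_inv_sigma: "sigma_inv (sigma p) = p" "sigma (sigma_inv p) = p"
proof -
  have "pcompose [:-1, 1:] [:1, 1:] = ([:0, 1:] :: complex poly)"
    "pcompose [:1, 1:] [:-1, 1:] = ([:0, 1:] :: complex poly)"
    by (simp_all add: pcompose_pCons)
  then show "sigma_inv (sigma p) = p" "sigma (sigma_inv p) = p"
    unfolding sigma_def sigma_inv_def by (metis pcompose_assoc pcompose_idR)+
qed

text \<open>\<open>\<complex>[h]\<^sup>n\<close> as a complex vector space. The library's \<open>module_vec\<close> is not applicable: there the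
  scalars are the vector entries.\<close>

definition poly_vec_space :: "nat \<Rightarrow> (complex, complex poly vec) module" where
  "poly_vec_space n = \<lparr>carrier = carrier_vec n, mult = undefined, one = undefined,
     zero = 0\<^sub>v n, add = (+), smult = (\<lambda>c v. [:c:] \<cdot>\<^sub>v v)\<rparr>"

text \<open>For \<open>n \<times> n\<close> matrices with \<open>E \<sigma>(F) - F \<sigma>\<^sup>-\<^sup>1(E) = 2h I\<close> this is an \<open>\<ss>\<ll>(2)\<close>-module; the
  definition itself does not impose that relation.\<close>

definition sl2_M :: "nat \<Rightarrow> complex poly mat \<Rightarrow> complex poly mat \<Rightarrow> complex poly vec sl2_mod" where
  "sl2_M n E F = sl2_extend (poly_vec_space n)
     (\<lambda>v. E *\<^sub>v map_vec sigma v)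
     (\<lambda>v. F *\<^sub>v map_vec sigma_inv v)
     (\<lambda>v. [:0, 1:] \<cdot>\<^sub>v v)"

definition lam :: "complex \<Rightarrow> complex poly" where
  "lam \<alpha> = - ([:1 - \<alpha>, 1:] * [:\<alpha>, 1:])"

definition P_size :: "nat \<times> int \<times> nat \<Rightarrow> nat" where
  "P_size = (\<lambda>(am, a0, ap). am + nat \<bar>a0\<bar> + ap)"

definition P_diagonal :: "nat \<times> int \<times> nat \<Rightarrow> complex \<Rightarrow> complex poly list" where
  "P_diagonal = (\<lambda>(am, a0, ap) \<alpha>.
     replicate am 1 @
     replicate (nat \<bar>a0\<bar>) (if a0 \<ge> 0 then [:1 - \<alpha>, 1:] else [:\<alpha>, 1:]) @
     replicate ap ([:1 - \<alpha>, 1:] * [:\<alpha>, 1:]))"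

definition P_mat :: "nat \<times> int \<times> nat \<Rightarrow> complex \<Rightarrow> complex poly mat" where
  "P_mat a \<alpha> = mat_diag (P_size a) (\<lambda>i. P_diagonal a \<alpha> ! i)"

definition Pbar_mat :: "nat \<times> int \<times> nat \<Rightarrow> complex \<Rightarrow> complex poly mat" where
  "Pbar_mat a \<alpha> = (THE Q. Q \<in> carrier_mat (P_size a) (P_size a) \<and> diagonal_mat Q \<and>
     Q * P_mat a \<alpha> = lam \<alpha> \<cdot>\<^sub>m 1\<^sub>m (P_size a))"

lemma length_P_diagonal: "length (P_diagonal a \<alpha>) = P_size a"
  by (cases a) (simp add: P_diagonal_def P_size_def)

text \<open>The defining conditions determine the matrix, so the definite description is unique.\<close>

lemma Pbar_mat_eqI:
  assumes "Q \<in> carrier_mat (P_size a) (P_size a)" "diagonal_mat Q"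
    and "Q * P_mat a \<alpha> = lam \<alpha> \<cdot>\<^sub>m 1\<^sub>m (P_size a)"
  shows "Pbar_mat a \<alpha> = Q"
  unfolding Pbar_mat_def
proof (rule the_equality, use assms in simp, elim conjE)
  fix R
  assume R: "R \<in> carrier_mat (P_size a) (P_size a)"
    "R * P_mat a \<alpha> = lam \<alpha> \<cdot>\<^sub>m 1\<^sub>m (P_size a)"
  have nz: "P_diagonal a \<alpha> ! i \<noteq> 0" if "i < P_size a" for i
  proof -
    have "P_diagonal a \<alpha> ! i \<in> set (P_diagonal a \<alpha>)" using that by (simp add: length_P_diagonal)
    then show ?thesis by (cases a) (auto simp: P_diagonal_def split: if_splits)
  qed
  show "R = Q"
  proof (rule eq_matI)
    fix i j assume ij: "i < dim_row Q" "j < dim_col Q"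
    have "(Q * P_mat a \<alpha>) $$ (i,j) = (R * P_mat a \<alpha>) $$ (i,j)" using assms R by simp
    then show "R $$ (i,j) = Q $$ (i,j)" using ij assms R nz
      unfolding P_mat_def by (subst (asm) (1 2) mat_diag_mult_right[of _ "P_size a"]) auto
  qed (use assms R in auto)
qed

text \<open>The invertible elements of the library's ring of \<open>n \<times> n\<close> matrices.\<close>

abbreviation GL :: "'a :: comm_ring_1 itself \<Rightarrow> nat \<Rightarrow> 'a mat set" where
  "GL ty n \<equiv> Units (ring_mat ty n ())"

text \<open>Intended for \<open>K \<in> GL TYPE(complex poly) (P_size a)\<close>.\<close>

definition sl2_M_alpha ::
  "complex \<Rightarrow> nat \<times> int \<times> nat \<Rightarrow> complex poly mat \<Rightarrow> complex poly vec sl2_mod" where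
  "sl2_M_alpha \<alpha> a K = sl2_M (P_size a)
     (map_mat sigma (inv\<^bsub>ring_mat TYPE(complex poly) (P_size a) ()\<^esub> K * Pbar_mat a \<alpha>))
     (P_mat a \<alpha> * K)"


section \<open>The module \<open>T\<^sub>3(g)\<close>\<close>

text \<open>The element \<open>p e\<^sup>g\<close> of \<open>\<complex>[t] e\<^sup>g\<close> is represented by the polynomial \<open>p\<close>.\<close>

definition exp_pderiv :: "complex poly \<Rightarrow> complex poly \<Rightarrow> complex poly" where
  "exp_pderiv g p = pderiv p + p * pderiv g"

definition poly_space :: "(complex, complex poly) module" where
  "poly_space = \<lparr>carrier = UNIV, mult = undefined, one = undefined,
     zero = 0, add = (+), smult = Polynomial.smult\<rparr>"

definition T3 :: "complex poly \<Rightarrow> complex poly sl2_mod" where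
  "T3 g = sl2_extend poly_space
     (\<lambda>p. Polynomial.smult (1/2) ([:0, 1:]^2 * p))
     (\<lambda>p. Polynomial.smult (-1/2) (exp_pderiv g (exp_pderiv g p)))
     (\<lambda>p. Polynomial.smult (1/2) ([:0, 1:] * exp_pderiv g p) + Polynomial.smult (1/4) p)"

definition poly_even :: "complex poly set" where
  "poly_even = LinearCombinations.module.span class_ring poly_space (range (\<lambda>k. monom 1 (2 * k)))"

definition poly_odd :: "complex poly set" where
  "poly_odd = LinearCombinations.module.span class_ring poly_space (range (\<lambda>k. monom 1 (2 * k + 1)))"

definition T3_ev :: "complex poly \<Rightarrow> complex poly sl2_mod" where
  "T3_ev g = (T3 g)\<lparr>carrier := poly_even\<rparr>"

definition T3_odd :: "complex poly \<Rightarrow> complex poly sl2_mod" where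
  "T3_odd g = (T3 g)\<lparr>carrier := poly_odd\<rparr>"

text \<open>Only the values of \<open>a\<close> at even indices enter: \<open>a (2 * j)\<close> is the coefficient \<open>a\<^sub>2\<^sub>j\<close>.
  Rows and columns are numbered from \<open>0\<close>, so row \<open>i\<close> begins with \<open>-2(i+1) a\<^sub>2\<^sub>(\<^sub>i\<^sub>+\<^sub>1\<^sub>)\<close>.\<close>

definition K3 :: "nat \<Rightarrow> (nat \<Rightarrow> complex) \<Rightarrow> complex mat" where
  "K3 m a = mat m m (\<lambda>(i, j).
     if j = 0 then - 2 * of_nat (i + 1) * a (2 * (i + 1)) else if j = i + 1 then - 2 else 0)"

abbreviation const_mat :: "complex mat \<Rightarrow> complex poly mat" where
  "const_mat \<equiv> map_mat (\<lambda>c. [:c:])"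

end

theory Submission
  imports Defs
begin

text \<open>For \<open>s = 0, 1\<close> the polynomials of parity \<open>s\<close> form a free \<open>\<complex>[h]\<close>-module of rank \<open>m\<close>, because \<open>h\<close>
  raises the degree by exactly \<open>2m\<close>. The basis that produces the matrix \<open>K\<^sub>3\<close> is
  \<open>b\<^sub>0 = t\<^sup>s g' / (2t)\<close> and \<open>b\<^sub>i = t\<^bsup>2(i-1)+s\<^esup>\<close> for \<open>0 < i < m\<close>: in the basis
  \<open>-t\<^bsup>2j+s\<^esup> / 2\<close> their coordinates are the columns of \<open>K\<^sub>3\<close>, and \<open>t\<^sup>2 b\<^sub>i / 2 = t\<^bsup>2i+s\<^esup> / 2\<close> while
  \<open>t\<^sup>2 b\<^sub>0 / 2 = (h - s/2 - 1/4) t\<^sup>s / 2\<close>, which gives the entries of \<open>\<sigma>\<close> of the diagonal matrix.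
  So \<open>v \<mapsto> \<Sum> v\<^sub>i(h) b\<^sub>i\<close> commutes with \<open>h\<close> and \<open>e\<close>. It then commutes with \<open>f\<close>, since on both sides
  \<open>e f\<close> is multiplication by \<open>\<sigma>(\<lambda>)(h)\<close> and \<open>e\<close> is injective on polynomials. The \<open>\<ss>\<ll>(2)\<close>-relations on
  \<open>M(\<alpha>, a, K\<^sub>3)\<close> are inherited from \<open>T\<^sub>3(g)\<close> through this injective map.\<close>

section \<open>Transport of module structures\<close>

text \<open>Every axiom is an equation between vectors, so an injective equivariant map reflects it
  from \<open>W\<close> to \<open>V\<close>. This replaces a direct check of the relations, both for
  submodules and for the modules given by matrices.\<close>

lemma sl2_module_inj_hom:
  fixes V :: "('v, 'x) sl2_mod_scheme" and W :: "('w, 'y) sl2_mod_scheme"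
  assumes W: "sl2_module W"
    and hom: "linear_map (class_ring :: complex ring) V W \<phi>"
    and inj: "inj_on \<phi> (carrier V)"
    and closed: "\<And>u v. v \<in> carrier V \<Longrightarrow> act V u v \<in> carrier V"
    and equivariant: "\<And>u v. v \<in> carrier V \<Longrightarrow> \<phi> (act V u v) = act W u (\<phi> v)"
  shows "sl2_module V"
proof -
  interpret W: sl2_module W by (rule W)
  interpret V: vectorspace "class_ring :: complex ring" V
    using hom by (simp add: linear_map_def)
  interpret \<phi>: linear_map "class_ring :: complex ring" V W \<phi> by (rule hom)
  have smult: "\<phi> (c \<odot>\<^bsub>V\<^esub> v) = c \<odot>\<^bsub>W\<^esub> \<phi> v" if "v \<in> carrier V" for c v
    using that \<phi>.f_smult by simp
  have smult_closed: "c \<odot>\<^bsub>V\<^esub> v \<in> carrier V" if "v \<in> carrier V" for c v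
    using that V.smult_closed by simp
  note eqI = inj_onD[OF inj]
  show ?thesis
  proof (unfold_locales, goal_cases)
    case (1 v u) then show ?case by (rule closed)
  next
    case (2 v w u) then show ?case
      by (intro eqI) (simp_all add: closed equivariant W.act_add)
  next
    case (3 v u c) then show ?case
      by (intro eqI) (simp_all add: closed equivariant W.act_smult smult smult_closed)
  next
    case (4 v u u') then show ?case
      by (intro eqI) (simp_all add: closed equivariant W.add_act)
  next
    case (5 v c u) then show ?case
      by (intro eqI) (simp_all add: closed equivariant W.scale_act smult smult_closed)
  next
    case (6 v u u') then show ?case
      by (intro eqI) (simp_all add: closed equivariant W.bracket_act)
  qed
qed

text \<open>The comparison map is most easily defined on the matrix side, out of a free module,
  whereas the isomorphism is wanted in the other direction. The inverse bijection provides it, and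
  \<open>V\<close> becomes a module by the injectivity criterion.\<close>

lemma sl2_isomorphic_inverseI:
  fixes V :: "'v sl2_mod" and W :: "'w sl2_mod"
  assumes W: "sl2_module W"
    and hom: "linear_map (class_ring :: complex ring) V W \<phi>"
    and bij: "bij_betw \<phi> (carrier V) (carrier W)"
    and closed: "\<And>u v. v \<in> carrier V \<Longrightarrow> act V u v \<in> carrier V"
    and equivariant: "\<And>u v. v \<in> carrier V \<Longrightarrow> \<phi> (act V u v) = act W u (\<phi> v)"
  shows "sl2_isomorphic W V"
proof -
  have V: "sl2_module V"
    using W hom bij_betw_imp_inj_on[OF bij] closed equivariant by (rule sl2_module_inj_hom)
  interpret V: sl2_module V by (rule V)
  interpret W: sl2_module W by (rule W)
  interpret \<phi>: linear_map "class_ring :: complex ring" V W \<phi> by (rule hom)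
  define \<psi> where "\<psi> = inv_into (carrier V) \<phi>"
  have \<psi>: "bij_betw \<psi> (carrier W) (carrier V)"
    unfolding \<psi>_def by (rule bij_betw_inv_into[OF bij])
  then have \<psi>_closed: "\<psi> w \<in> carrier V" if "w \<in> carrier W" for w
    using that bij_betwE by blast
  have \<phi>\<psi>: "\<phi> (\<psi> w) = w" if "w \<in> carrier W" for w
    using that bij unfolding \<psi>_def by (simp add: bij_betw_inv_into_right)
  have \<psi>_eqI: "\<psi> w = v" if "v \<in> carrier V" "w = \<phi> v" for v w
    using that bij unfolding \<psi>_def by (simp add: bij_betw_inv_into_left)
  have smult: "\<phi> (c \<odot>\<^bsub>V\<^esub> v) = c \<odot>\<^bsub>W\<^esub> \<phi> v" "c \<odot>\<^bsub>V\<^esub> v \<in> carrier V" if "v \<in> carrier V" for c v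
    using that \<phi>.f_smult V.smult_closed by simp_all
  have "\<psi> \<in> LinearCombinations.module_hom (class_ring :: complex ring) W V"
    unfolding LinearCombinations.module_hom_def
    by (auto simp: \<psi>_closed \<phi>\<psi> smult intro!: \<psi>_eqI)
  then have "linear_map (class_ring :: complex ring) W V \<psi>"
    by unfold_locales
  moreover have "\<forall>u. \<forall>w\<in>carrier W. \<psi> (act W u w) = act V u (\<psi> w)"
    by (auto intro!: \<psi>_eqI simp: closed \<psi>_closed equivariant \<phi>\<psi>)
  ultimately show ?thesis
    unfolding sl2_isomorphic_def using V W \<psi> by blast
qed

lemma sl2_submodule_imp_module:
  fixes V :: "'v sl2_mod"
  assumes "sl2_submodule V U"
  shows "sl2_module (V\<lparr>carrier := U\<rparr>)"
proof -
  have V: "sl2_module V" and U: "VectorSpace.subspace (class_ring :: complex ring) U V"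
    and closed: "\<And>u w. w \<in> U \<Longrightarrow> act V u w \<in> U"
    using assms unfolding sl2_submodule_def by auto
  interpret V: sl2_module V by (rule V)
  interpret U: vectorspace "class_ring :: complex ring" "V\<lparr>carrier := U\<rparr>"
    by (rule V.subspace_is_vs[OF U])
  have sub: "U \<subseteq> carrier V"
    using U unfolding VectorSpace.subspace_def submodule_def by blast
  have "id \<in> LinearCombinations.module_hom (class_ring :: complex ring) (V\<lparr>carrier := U\<rparr>) V"
    unfolding LinearCombinations.module_hom_def using sub by auto
  then have "linear_map (class_ring :: complex ring) (V\<lparr>carrier := U\<rparr>) V id"
    by unfold_locales
  then show ?thesis
    by (rule sl2_module_inj_hom[OF V]) (use closed in auto)
qed

section \<open>Underlying complex vector spaces of the concrete modules\<close>

lemma sl2_M_simps [simp]: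
  "carrier (sl2_M n E F) = carrier_vec n"
  "zero (sl2_M n E F) = 0\<^sub>v n"
  "add (sl2_M n E F) = (+)"
  "module.smult (sl2_M n E F) = (\<lambda>c v. [:c:] \<cdot>\<^sub>v v)"
  by (simp_all add: sl2_M_def sl2_extend_def poly_vec_space_def module.defs)

lemma act_sl2_M: "act (sl2_M n E F) (x, y, z) v =
   [:x:] \<cdot>\<^sub>v (E *\<^sub>v map_vec sigma v) + [:y:] \<cdot>\<^sub>v (F *\<^sub>v map_vec sigma_inv v)
   + [:z:] \<cdot>\<^sub>v ([:0, 1:] \<cdot>\<^sub>v v)"
  by (simp add: sl2_M_def sl2_extend_def poly_vec_space_def module.defs)

lemma sl2_M_vectorspace: "vectorspace (class_ring :: complex ring) (sl2_M n E F)"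
proof -
  have inv: "\<exists>y\<in>carrier_vec n. v + y = 0\<^sub>v n" if "v \<in> carrier_vec n" for v :: "complex poly vec"
    using that by (intro bexI[of _ "- v"]) auto
  show ?thesis
    by unfold_locales
      (auto simp: class_ring_simps Units_def smult_add_distrib_vec smult_smult_assoc comm_add_vec
         add_smult_distrib_vec[symmetric] one_pCons[symmetric] mult.commute intro!: inv)
qed

lemma poly_space_simps [simp]:
  "carrier poly_space = UNIV" "zero poly_space = 0" "add poly_space = (+)"
  "module.smult poly_space = Polynomial.smult"
  by (simp_all add: poly_space_def)

lemma T3_simps [simp]:
  "carrier (T3 g) = UNIV" "zero (T3 g) = 0" "add (T3 g) = (+)"
  "module.smult (T3 g) = Polynomial.smult"
  by (simp_all add: T3_def sl2_extend_def module.defs)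

lemma poly_space_vectorspace: "vectorspace (class_ring :: complex ring) poly_space"
  by unfold_locales
    (auto simp: class_ring_simps Units_def smult_add_left smult_add_right algebra_simps
      intro!: exI[of _ "- _"])

lemma T3_vectorspace: "vectorspace (class_ring :: complex ring) (T3 g)"
  by unfold_locales
    (auto simp: class_ring_simps Units_def smult_add_left smult_add_right algebra_simps
      intro!: exI[of _ "- _"])

section \<open>Polynomials in an operator\<close>

lemma sigma_hom: "comm_ring_hom sigma"
  by unfold_locales (simp_all add: sigma_def pcompose_add pcompose_mult one_pCons)

interpretation sigma: comm_ring_hom sigma by (rule sigma_hom)

lemma sigma_pCons: "sigma (pCons c p) = [:c:] + [:-1, 1:] * sigma p"
  by (simp add: sigma_def pcompose_pCons)

lemma sigma_const [simp]: "sigma [:c:] = [:c:]"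
  by (simp add: sigma_def)

text \<open>The operator p(H) applied to \<open>q\<close>, in Horner form: it makes the polynomials
  in t a module over C[h] in which h acts as \<open>H\<close>.\<close>

definition op_poly ::
  "(complex poly \<Rightarrow> complex poly) \<Rightarrow> complex poly \<Rightarrow> complex poly \<Rightarrow> complex poly" where
  "op_poly H p q = fold_coeffs (\<lambda>c r. Polynomial.smult c q + H r) p 0"

locale linear_op =
  fixes H :: "complex poly \<Rightarrow> complex poly"
  assumes add: "H (p + q) = H p + H q"
    and smult: "H (Polynomial.smult c p) = Polynomial.smult c (H p)"
begin

lemma zero [simp]: "H 0 = 0"
  using smult[of 0 0] by simp

lemma sum: "H (\<Sum>i\<in>A. p i) = (\<Sum>i\<in>A. H (p i))"
  by (induction A rule: infinite_finite_induct) (simp_all add: add)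

lemma minus: "H (- p) = - H p"
  using smult[of "-1" p] by simp

lemma diff: "H (p - q) = H p - H q"
  using add[of p "- q"] by (simp add: minus)

lemma op_poly_0 [simp]: "op_poly H 0 q = 0"
  by (simp add: op_poly_def)

lemma op_poly_pCons [simp]: "op_poly H (pCons c p) q = Polynomial.smult c q + H (op_poly H p q)"
  by (cases "c = 0 \<and> p = 0") (auto simp: op_poly_def)

lemma op_poly_add: "op_poly H (p + p') q = op_poly H p q + op_poly H p' q"
  by (induction p p' rule: poly_induct2) (simp_all add: smult_add_left add algebra_simps)

lemma op_poly_smult: "op_poly H (Polynomial.smult c p) q = Polynomial.smult c (op_poly H p q)"
  by (induction p) (simp_all add: smult_add_right smult)

lemma op_poly_diff: "op_poly H (p - p') q = op_poly H p q - op_poly H p' q"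
  using op_poly_add[of p "- p'" q] op_poly_smult[of "-1" p' q] by simp

lemma op_poly_mult: "op_poly H (p * p') q = op_poly H p (op_poly H p' q)"
  by (induction p) (simp_all add: op_poly_add op_poly_smult)

lemma op_poly_sum: "op_poly H (\<Sum>i\<in>A. p i) q = (\<Sum>i\<in>A. op_poly H (p i) q)"
  by (induction A rule: infinite_finite_induct) (simp_all add: op_poly_add)

lemma linear_op_poly: "linear_op (op_poly H p)"
proof
  show "op_poly H p (q + q') = op_poly H p q + op_poly H p q'" for q q'
    by (induction p) (simp_all add: smult_add_right add algebra_simps)
  show "op_poly H p (Polynomial.smult c q) = Polynomial.smult c (op_poly H p q)" for c q
    by (induction p) (simp_all add: smult_add_right smult mult.commute)
qed

text \<open>The hypothesis reads e H = (H - 1) e, so moving \<open>e\<close> past a polynomial in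
  \<open>H\<close> replaces h by h - 1, which is \<open>sigma\<close>.\<close>

lemma op_poly_shift:
  assumes e: "linear_op e" and comm: "\<And>q. e (H q) = H (e q) - e q"
  shows "e (op_poly H p q) = op_poly H (sigma p) (e q)"
proof -
  interpret e: linear_op e by (rule e)
  show ?thesis
    by (induction p) (simp_all add: sigma_pCons op_poly_add op_poly_mult op_poly_diff e.add e.smult comm)
qed

text \<open>In each Horner step the new scalar multiple of \<open>q\<close> has degree at most
  \<open>degree q\<close>, while the part under \<open>H\<close> has degree at least
  \<open>degree q + d\<close>. Leading terms never cancel, so there is no torsion over C[h].\<close>

lemma op_poly_degree:
  assumes deg: "\<And>q. q \<noteq> 0 \<Longrightarrow> degree (H q) = degree q + d" and "d > 0"
    and p: "p \<noteq> 0" and q: "q \<noteq> 0"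
  shows "op_poly H p q \<noteq> 0 \<and> degree (op_poly H p q) = degree q + degree p * d"
  using p
proof (induction p)
  case (pCons c p)
  show ?case
  proof (cases "p = 0")
    case True
    then show ?thesis using pCons q by simp
  next
    case False
    let ?r = "H (op_poly H p q)"
    have IH: "op_poly H p q \<noteq> 0" "degree (op_poly H p q) = degree q + degree p * d"
      using pCons False by auto
    then have r: "degree ?r = degree q + degree (pCons c p) * d"
      using deg False by simp
    then have "degree (Polynomial.smult c q) < degree ?r"
      using degree_smult_le[of c q] \<open>d > 0\<close> False by simp
    then have "degree (Polynomial.smult c q + ?r) = degree ?r"
      by (rule degree_add_eq_right)
    then show ?thesis
      using r \<open>d > 0\<close> False by auto
  qed
qed simp

end

text \<open>Among the nonzero summands the largest degree occurs only once, so its leading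
  coefficient survives in the sum.\<close>

lemma sum_distinct_degrees_nonzero:
  fixes p :: "'i \<Rightarrow> 'a :: comm_ring_1 poly"
  assumes "finite I" and i: "i \<in> I" "p i \<noteq> 0"
    and distinct: "\<And>j k. \<lbrakk>j \<in> I; k \<in> I; p j \<noteq> 0; p k \<noteq> 0; degree (p j) = degree (p k)\<rbrakk> \<Longrightarrow> j = k"
  shows "sum p I \<noteq> 0"
proof -
  let ?J = "{j \<in> I. p j \<noteq> 0}"
  have J: "finite ?J" "?J \<noteq> {}" using assms by auto
  have "Max ((\<lambda>j. degree (p j)) ` ?J) \<in> (\<lambda>j. degree (p j)) ` ?J"
    using J by (intro Max_in) auto
  then obtain k where k: "k \<in> I" "p k \<noteq> 0" "degree (p k) = Max ((\<lambda>j. degree (p j)) ` ?J)"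
    by auto
  have "coeff (p j) (degree (p k)) = 0" if "j \<in> I" "j \<noteq> k" for j
  proof (cases "p j = 0")
    case False
    then have "degree (p j) \<le> degree (p k)"
      using J that k(3) by simp
    then show ?thesis
      using distinct[of j k] that k False by (intro coeff_eq_0) force
  qed simp
  then have "coeff (sum p I) (degree (p k)) = coeff (p k) (degree (p k))"
    using \<open>finite I\<close> k(1) by (simp add: coeff_sum sum.remove[of I k])
  then show ?thesis using k(2) by auto
qed

section \<open>Polynomials of a fixed parity\<close>

definition parity_polys :: "nat \<Rightarrow> complex poly set" where
  "parity_polys s = {p. \<forall>n. odd (n + s) \<longrightarrow> coeff p n = 0}"

text \<open>A polynomial of parity \<open>s\<close> is a combination of the monomials in the
  hypothesis \<open>monom\<close>. The lemma serves for the spans that define the even and odd parts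
  and for the image of the comparison map.\<close>

lemma parity_polys_induct:
  assumes zero: "0 \<in> U" and add: "\<And>p q. p \<in> U \<Longrightarrow> q \<in> U \<Longrightarrow> p + q \<in> U"
    and smult: "\<And>c p. p \<in> U \<Longrightarrow> Polynomial.smult c p \<in> U"
    and monom: "\<And>k. monom 1 (2 * k + s) \<in> U" and "s \<le> 1"
  shows "parity_polys s \<subseteq> U"
proof
  fix p assume p: "p \<in> parity_polys s"
  have "monom (coeff p n) n \<in> U" for n
  proof (cases "even (n + s)")
    case True
    \<comment> \<open>With \<open>s \<le> 1\<close> the number \<open>s\<close> is the remainder of
      \<open>n\<close> modulo 2.\<close>
    then have "n = 2 * (n div 2) + s"
      using \<open>s \<le> 1\<close> by (cases "s = 0") (auto elim!: oddE simp: le_Suc_eq)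
    then have "monom 1 n \<in> U"
      using monom[of "n div 2"] by simp
    from smult[OF this, of "coeff p n"] show ?thesis
      by (simp add: smult_monom)
  next
    case False
    then show ?thesis using p zero by (simp add: parity_polys_def)
  qed
  then have "(\<Sum>n\<in>A. monom (coeff p n) n) \<in> U" for A
    by (induction A rule: infinite_finite_induct) (simp_all add: zero add)
  from this[of "{..degree p}"] show "p \<in> U"
    by (simp add: poly_as_sum_of_monoms)
qed

lemma parity_polys_subspace:
  "0 \<in> parity_polys s"
  "p \<in> parity_polys s \<Longrightarrow> q \<in> parity_polys s \<Longrightarrow> p + q \<in> parity_polys s"
  "p \<in> parity_polys s \<Longrightarrow> Polynomial.smult c p \<in> parity_polys s"
  by (simp_all add: parity_polys_def)

lemma monom_parity_polys: "even (n + s) \<Longrightarrow> monom c n \<in> parity_polys s"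
  by (auto simp: parity_polys_def)

lemma span_monoms_eq_parity_polys:
  assumes "s \<le> 1"
  shows "LinearCombinations.module.span class_ring poly_space (range (\<lambda>k. monom 1 (2 * k + s)))
    = parity_polys s" (is "?S = _")
proof
  interpret vectorspace "class_ring :: complex ring" poly_space
    by (rule poly_space_vectorspace)
  have "LinearCombinations.submodule class_ring (parity_polys s) poly_space"
    by unfold_locales (simp_all add: parity_polys_subspace)
  then show "?S \<subseteq> parity_polys s"
    by (rule span_is_subset[rotated]) (auto intro!: monom_parity_polys)
  have S: "LinearCombinations.submodule class_ring ?S poly_space"
    by (rule span_is_submodule) simp
  show "parity_polys s \<subseteq> ?S"
  proof (rule parity_polys_induct[OF _ _ _ _ assms])
    show "0 \<in> ?S" using submodule.zero_closed[OF S] by simp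
    show "p + q \<in> ?S" if "p \<in> ?S" "q \<in> ?S" for p q
      using submodule.m_closed[OF S that] by simp
    show "Polynomial.smult c p \<in> ?S" if "p \<in> ?S" for c p
      using submodule.smult_closed[OF S _ that, of c] by simp
    show "monom 1 (2 * k + s) \<in> ?S" for k
      using in_own_span[of "range (\<lambda>k. monom 1 (2 * k + s))"] by auto
  qed
qed

lemma poly_even_eq: "poly_even = parity_polys 0"
  using span_monoms_eq_parity_polys[of 0] by (simp add: poly_even_def)

lemma poly_odd_eq: "poly_odd = parity_polys 1"
  using span_monoms_eq_parity_polys[of 1] by (simp add: poly_odd_def)

section \<open>The parity decomposition\<close>

text \<open>The square of t is split into two factors so that the product rule
  \<open>exp_pderiv_X_mult\<close> applies to each.\<close>

definition T3_e :: "complex poly \<Rightarrow> complex poly" where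
  "T3_e p = Polynomial.smult (1/2) ([:0, 1:] * ([:0, 1:] * p))"

definition T3_f :: "complex poly \<Rightarrow> complex poly \<Rightarrow> complex poly" where
  "T3_f g p = Polynomial.smult (-1/2) (exp_pderiv g (exp_pderiv g p))"

definition T3_h :: "complex poly \<Rightarrow> complex poly \<Rightarrow> complex poly" where
  "T3_h g p = Polynomial.smult (1/2) ([:0, 1:] * exp_pderiv g p) + Polynomial.smult (1/4) p"

lemma act_T3: "act (T3 g) (x, y, z) p =
    Polynomial.smult x (T3_e p) + Polynomial.smult y (T3_f g p) + Polynomial.smult z (T3_h g p)"
  by (simp add: T3_def sl2_extend_def module.defs T3_e_def T3_f_def T3_h_def power2_eq_square)

lemma exp_pderiv_add: "exp_pderiv g (p + q) = exp_pderiv g p + exp_pderiv g q"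
  by (simp add: exp_pderiv_def pderiv_add algebra_simps)

lemma exp_pderiv_smult: "exp_pderiv g (Polynomial.smult c p) = Polynomial.smult c (exp_pderiv g p)"
  by (simp add: exp_pderiv_def pderiv_smult smult_add_right)

text \<open>The Weyl relation between t and the conjugated derivative. It is free of
  \<open>g\<close>, so identities derived from it hold for every exponent.\<close>

lemma exp_pderiv_X_mult: "exp_pderiv g ([:0, 1:] * p) = p + [:0, 1:] * exp_pderiv g p"
  unfolding exp_pderiv_def pderiv_mult by (simp add: pderiv_pCons algebra_simps)

lemma linear_T3_e: "linear_op T3_e"
  by unfold_locales (simp_all add: T3_e_def smult_add_right)

lemma linear_T3_f: "linear_op (T3_f g)"
  by unfold_locales (simp_all add: T3_f_def exp_pderiv_add exp_pderiv_smult smult_add_right)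

lemma linear_T3_h: "linear_op (T3_h g)"
  by unfold_locales
    (simp_all add: T3_h_def exp_pderiv_add exp_pderiv_smult smult_add_right algebra_simps)

text \<open>All four identities follow from the Weyl relation. The last one says that the Casimir
  element h^2 - h + e f acts by the scalar -3/16; this number determines the choice of
  \<alpha>.\<close>

lemma T3_relations:
  shows T3_h_e: "T3_h g (T3_e p) = T3_e (T3_h g p) + T3_e p"
    and T3_h_f: "T3_h g (T3_f g p) = T3_f g (T3_h g p) - T3_f g p"
    and T3_e_f: "T3_e (T3_f g p) = T3_f g (T3_e p) + Polynomial.smult 2 (T3_h g p)"
    and T3_e_f_h: "T3_e (T3_f g p) =
      T3_h g p - T3_h g (T3_h g p) - Polynomial.smult (3/16) p"
proof -
  \<comment> \<open>With t kept as an opaque factor, rewriting by \<open>D\<close> leaves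
    combinations of iterated products with \<open>X\<close> of derivatives of \<open>p\<close>,
    which are compared coefficientwise.\<close>
  define X :: "complex poly" where "X = [:0, 1:]"
  have D: "exp_pderiv g (X * q) = q + X * exp_pderiv g q" for q
    unfolding X_def by (rule exp_pderiv_X_mult)
  note simps = T3_e_def T3_f_def T3_h_def X_def[symmetric] D exp_pderiv_add exp_pderiv_smult
    distrib_left smult_add_right mult_smult_right
  show "T3_h g (T3_e p) = T3_e (T3_h g p) + T3_e p"
    unfolding simps by (rule poly_eqI) (simp only: coeff_add coeff_diff coeff_smult, simp add: algebra_simps)
  show "T3_h g (T3_f g p) = T3_f g (T3_h g p) - T3_f g p"
    unfolding simps by (rule poly_eqI) (simp only: coeff_add coeff_diff coeff_smult, simp add: algebra_simps)
  show "T3_e (T3_f g p) = T3_f g (T3_e p) + Polynomial.smult 2 (T3_h g p)"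
    unfolding simps by (rule poly_eqI) (simp only: coeff_add coeff_diff coeff_smult, simp add: algebra_simps)
  show "T3_e (T3_f g p) = T3_h g p - T3_h g (T3_h g p) - Polynomial.smult (3/16) p"
    unfolding simps by (rule poly_eqI) (simp only: coeff_add coeff_diff coeff_smult, simp add: algebra_simps)
qed

lemma T3_minus: "p \<ominus>\<^bsub>T3 g\<^esub> q = p - q"
proof -
  interpret vectorspace "class_ring :: complex ring" "T3 g" by (rule T3_vectorspace)
  have "\<ominus>\<^bsub>T3 g\<^esub> q = - q"
    by (rule minus_equality) simp_all
  then show ?thesis by (simp add: a_minus_def)
qed

lemma T3_module: "sl2_module (T3 g)"
proof -
  interpret vectorspace "class_ring :: complex ring" "T3 g" by (rule T3_vectorspace)
  interpret e: linear_op T3_e by (rule linear_T3_e)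
  interpret f: linear_op "T3_f g" by (rule linear_T3_f)
  interpret h: linear_op "T3_h g" by (rule linear_T3_h)
  note linear = e.add e.smult f.add f.smult h.add h.smult
  note coeffs = coeff_add coeff_diff coeff_smult
  show ?thesis
  proof (unfold_locales, goal_cases)
    case (1 v u) then show ?case by simp
  next
    case (2 v w u) then show ?case
      by (cases u) (simp add: act_T3 linear smult_add_right)
  next
    case (3 v u c) then show ?case
      by (cases u) (simp add: act_T3 linear smult_add_right mult.commute)
  next
    case (4 v u u') then show ?case
      by (cases u; cases u') (simp add: act_T3 smult_add_left)
  next
    case (5 v c u) then show ?case
      by (cases u) (simp add: act_T3 smult_add_right)
  next
    case (6 v u u')
    obtain x y z x' y' z' where u: "u = (x, y, z)" "u' = (x', y', z')"
      by (metis prod_cases3)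
    show ?case
      unfolding u sl2_bracket.simps act_T3 linear T3_minus T3_h_e T3_h_f T3_e_f
      by (rule poly_eqI) (simp add: algebra_simps)
  qed
qed

lemma T3_e_inj: "T3_e p = T3_e q \<Longrightarrow> p = q"
  by (drule arg_cong[of _ _ "Polynomial.smult 2"]) (simp add: T3_e_def)

text \<open>For \<alpha> = 1/4 the product \<open>\<alpha> * (1 - \<alpha>)\<close> is 3/16, so
  \<open>sigma (lam \<alpha>)\<close> is h - h^2 - 3/16, as in the Casimir relation
  \<open>T3_e_f_h\<close>.\<close>

lemma op_poly_sigma_lam: "op_poly (T3_h g) (sigma (lam (1/4))) p = T3_e (T3_f g p)"
proof -
  interpret h: linear_op "T3_h g" by (rule linear_T3_h)
  have "sigma (lam (1/4)) = [:-3/16, 1, -1:]"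
    by (simp add: lam_def sigma_def pcompose_pCons)
  then show ?thesis
    by (simp add: T3_e_f_h h.add h.smult h.minus h.diff)
qed

section \<open>Compatibility of the action with parity\<close>

lemma X_mult_parity_polys: "p \<in> parity_polys s \<Longrightarrow> [:0, 1:] * p \<in> parity_polys (Suc s)"
  by (auto simp: parity_polys_def coeff_pCons split: nat.splits)

lemma parity_polys_Suc_Suc: "parity_polys (Suc (Suc s)) = parity_polys s"
  by (simp add: parity_polys_def)

lemma pderiv_parity_polys: "p \<in> parity_polys s \<Longrightarrow> pderiv p \<in> parity_polys (Suc s)"
  by (auto simp: parity_polys_def coeff_pderiv)

text \<open>At an exponent of the wrong parity, each term of the convolution has a factor whose own
  exponent is of the wrong parity.\<close>

lemma mult_parity_polys:
  assumes "p \<in> parity_polys s" "q \<in> parity_polys r"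
  shows "p * q \<in> parity_polys (s + r)"
proof -
  have "coeff p i * coeff q (n - i) = 0" if "odd (n + (s + r))" "i \<le> n" for n i
  proof (cases "odd (i + s)")
    case False
    then have "odd (n - i + r)" using that by auto
    then show ?thesis using assms by (simp add: parity_polys_def)
  qed (use assms in \<open>simp add: parity_polys_def\<close>)
  then have "coeff (p * q) n = 0" if "odd (n + (s + r))" for n
    unfolding coeff_mult using that by (intro sum.neutral ballI) simp
  then show ?thesis by (simp add: parity_polys_def)
qed

text \<open>Multiplication by t and, because g' is odd, \<open>exp_pderiv g\<close> both reverse
  parity. Each of e, f and h composes two such operators, up to scalars and a scalar summand in
  h.\<close>

lemma parity_polys_act_T3:
  assumes g: "g \<in> parity_polys 0" and p: "p \<in> parity_polys s"
  shows "T3_h g p \<in> parity_polys s" "act (T3 g) u p \<in> parity_polys s"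
proof -
  have D: "exp_pderiv g q \<in> parity_polys (Suc r)" if "q \<in> parity_polys r" for q r
    using mult_parity_polys[OF that pderiv_parity_polys[OF g]] pderiv_parity_polys[OF that]
    unfolding exp_pderiv_def by (intro parity_polys_subspace) simp_all
  have e: "T3_e p \<in> parity_polys s"
    unfolding T3_e_def using X_mult_parity_polys[OF X_mult_parity_polys[OF p]]
    by (intro parity_polys_subspace) (simp only: parity_polys_Suc_Suc)
  have f: "T3_f g p \<in> parity_polys s"
    unfolding T3_f_def using D[OF D[OF p]]
    by (intro parity_polys_subspace) (simp only: parity_polys_Suc_Suc)
  show h: "T3_h g p \<in> parity_polys s"
    unfolding T3_h_def using X_mult_parity_polys[OF D[OF p]] p
    by (intro parity_polys_subspace) (simp_all only: parity_polys_Suc_Suc)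
  obtain x y z where "u = (x, y, z)" by (metis prod_cases3)
  then show "act (T3 g) u p \<in> parity_polys s"
    using e f h by (simp add: act_T3 parity_polys_subspace)
qed

lemma parity_polys_submodule:
  assumes "g \<in> parity_polys 0"
  shows "sl2_submodule (T3 g) (parity_polys s)"
proof -
  interpret vectorspace "class_ring :: complex ring" "T3 g" by (rule T3_vectorspace)
  have "VectorSpace.subspace (class_ring :: complex ring) (parity_polys s) (T3 g)"
    by unfold_locales (simp_all add: parity_polys_subspace)
  then show ?thesis
    unfolding sl2_submodule_def using T3_module parity_polys_act_T3[OF assms] by blast
qed

lemma T3_direct_sum:
  assumes "g \<in> parity_polys 0"
  shows "sl2_direct_sum (T3 g) (parity_polys 0) (parity_polys 1)"
proof -
  interpret vectorspace "class_ring :: complex ring" "T3 g" by (rule T3_vectorspace)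
  have "\<exists>q\<in>parity_polys 0. \<exists>r\<in>parity_polys 1. p = q + r" for p
  proof -
    define q where "q = (\<Sum>i\<in>{i. i \<le> degree p \<and> even i}. monom (coeff p i) i)"
    have "coeff q i = (if even i then coeff p i else 0)" for i
      by (auto simp: q_def coeff_sum sum.delta coeff_eq_0)
    then have "q \<in> parity_polys 0" "p - q \<in> parity_polys 1"
      by (auto simp: parity_polys_def)
    then show ?thesis by (metis add_diff_cancel_left' add.commute diff_add_cancel)
  qed
  then have "submodule_sum (parity_polys 0) (parity_polys 1) = UNIV"
    unfolding submodule_sum_def by (auto simp: image_iff Bex_def)
  moreover have "p = 0" if "p \<in> parity_polys 0" "p \<in> parity_polys 1" for p
  proof (rule poly_eqI)
    show "coeff p n = coeff 0 n" for n
      using that by (cases "even n") (simp_all add: parity_polys_def)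
  qed
  then have "parity_polys 0 \<inter> parity_polys 1 = {0}"
    using parity_polys_subspace(1) by blast
  ultimately show ?thesis
    unfolding sl2_direct_sum_def using parity_polys_submodule[OF assms] by simp
qed

section \<open>The matrices K3, P and Pbar\<close>

text \<open>Obtained by solving \<open>K3 m a\<close> x = y: the last row gives x_0 = -y_(m-1) / (2
  m a_(2m)), and row i - 1 then gives x_i = -y_(i-1) / 2 - i a_(2i) x_0.\<close>

definition K3_inv :: "nat \<Rightarrow> (nat \<Rightarrow> complex) \<Rightarrow> complex mat" where
  "K3_inv m a = mat m m (\<lambda>(i, j).
     (if i = j + 1 then - 1/2 else 0) +
     (if j = m - 1 then (if i = 0 then - 1 else of_nat i * a (2 * i)) / (2 * of_nat m * a (2 * m)) else 0))"

lemma K3_carrier [simp]: "K3 m a \<in> carrier_mat m m"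
  by (simp add: K3_def)

lemma K3_inv_carrier [simp]: "K3_inv m a \<in> carrier_mat m m"
  by (simp add: K3_inv_def)

lemma K3_mult_inv:
  assumes m: "m \<ge> 1" and a: "a (2 * m) \<noteq> 0"
  shows "K3 m a * K3_inv m a = 1\<^sub>m m"
proof (rule eq_matI)
  fix i j assume ij: "i < dim_row (1\<^sub>m m)" "j < dim_col (1\<^sub>m m)"
  let ?N = "\<lambda>k. K3_inv m a $$ (k, j)"
  have nz: "of_nat m * a (2 * m) \<noteq> 0" using assms by simp
  have "(K3 m a * K3_inv m a) $$ (i, j) = (\<Sum>k<m. K3 m a $$ (i, k) * ?N k)"
    using ij by (simp add: K3_def K3_inv_def scalar_prod_def atLeast0LessThan)
  \<comment> \<open>Row \<open>i\<close> can be nonzero only in columns 0 and \<open>i + 1\<close>;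
    the latter lies outside the matrix when \<open>i\<close> is the last row.\<close>
  also have "\<dots> = (\<Sum>k<m. (if k = 0 then - 2 * of_nat (i + 1) * a (2 * (i + 1)) * ?N 0 else 0)
      + (if k = i + 1 then - 2 * ?N (i + 1) else 0))"
    using ij by (intro sum.cong) (auto simp: K3_def)
  also have "\<dots> = - 2 * of_nat (i + 1) * a (2 * (i + 1)) * ?N 0
      + (if i + 1 < m then - 2 * ?N (i + 1) else 0)"
    using m by (simp add: sum.distrib sum.delta)
  also have "\<dots> = 1\<^sub>m m $$ (i, j)"
  proof (cases "i + 1 < m")
    case True
    then show ?thesis
      using ij nz by (auto simp: K3_inv_def field_simps)
  next
    case False
    then have "Suc i = m" using ij by simp
    then show ?thesis
      using ij nz by (auto simp: K3_inv_def field_simps)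
  qed
  finally show "(K3 m a * K3_inv m a) $$ (i, j) = 1\<^sub>m m $$ (i, j)" .
qed (simp_all add: K3_def K3_inv_def)

lemma K3_inv_mult:
  assumes "m \<ge> 1" "a (2 * m) \<noteq> 0"
  shows "K3_inv m a * K3 m a = 1\<^sub>m m"
  by (rule mat_mult_left_right_inverse[OF _ _ K3_mult_inv[of m a, OF assms]]) simp_all

lemma GL_iff:
  "A \<in> GL TYPE('a :: comm_ring_1) n \<longleftrightarrow> A \<in> carrier_mat n n \<and>
    (\<exists>B\<in>carrier_mat n n. B * A = 1\<^sub>m n \<and> A * B = 1\<^sub>m n)"
  by (auto simp: Units_def ring_mat_simps)

lemma K3_GL:
  assumes "m \<ge> 1" "a (2 * m) \<noteq> 0"
  shows "K3 m a \<in> GL TYPE(complex) m"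
  unfolding GL_iff using K3_mult_inv[of m a, OF assms] K3_inv_mult[of m a, OF assms] K3_inv_carrier K3_carrier by blast

lemma const_mat_GL:
  assumes "A \<in> GL TYPE(complex) n"
  shows "const_mat A \<in> GL TYPE(complex poly) n"
proof -
  interpret const: comm_ring_hom "\<lambda>c :: complex. [:c:]"
    by unfold_locales (simp_all add: one_pCons)
  obtain B where B: "A \<in> carrier_mat n n" "B \<in> carrier_mat n n" "B * A = 1\<^sub>m n" "A * B = 1\<^sub>m n"
    using assms unfolding GL_iff by blast
  have "const_mat B * const_mat A = 1\<^sub>m n" "const_mat A * const_mat B = 1\<^sub>m n"
    using const.mat_hom_mult[OF B(2,1)] const.mat_hom_mult[OF B(1,2)] B
    by (simp_all add: const.mat_hom_one)
  moreover have "const_mat A \<in> carrier_mat n n" "const_mat B \<in> carrier_mat n n"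
    using B by simp_all
  ultimately show ?thesis unfolding GL_iff by blast
qed

lemma GL_inv:
  fixes A :: "'a :: comm_ring_1 mat"
  assumes "A \<in> GL TYPE('a) n"
  defines "B \<equiv> inv\<^bsub>ring_mat TYPE('a) n ()\<^esub> A"
  shows "B \<in> carrier_mat n n" "B * A = 1\<^sub>m n" "A * B = 1\<^sub>m n" "A \<in> carrier_mat n n"
proof -
  interpret ring "ring_mat TYPE('a) n ()" by (rule ring_mat)
  show "B \<in> carrier_mat n n" "B * A = 1\<^sub>m n" "A * B = 1\<^sub>m n" "A \<in> carrier_mat n n"
    using Units_inv_closed[OF assms(1)] Units_l_inv[OF assms(1)] Units_r_inv[OF assms(1)]
      Units_closed[OF assms(1)]
    unfolding B_def by (simp_all add: ring_mat_simps)
qed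

section \<open>The diagonal matrices and the operators built from them\<close>

lemma P_diagonal_dvd_lam: "P_diagonal a \<alpha> ! i dvd lam \<alpha>" if "i < P_size a"
proof -
  have "P_diagonal a \<alpha> ! i \<in> set (P_diagonal a \<alpha>)"
    using that by (simp add: length_P_diagonal)
  then show ?thesis
    by (cases a) (auto simp: P_diagonal_def lam_def simp del: mult_pCons_left mult_pCons_right split: if_splits)
qed

text \<open>Each diagonal entry of \<open>P_mat\<close> divides \<open>lam \<alpha>\<close>, so
  exact entrywise division meets the conditions that characterise \<open>Pbar_mat\<close>.\<close>

lemma Pbar_mat_eq: "Pbar_mat a \<alpha> = mat_diag (P_size a) (\<lambda>i. lam \<alpha> div P_diagonal a \<alpha> ! i)"
proof (rule Pbar_mat_eqI)
  show "mat_diag (P_size a) (\<lambda>i. lam \<alpha> div P_diagonal a \<alpha> ! i) * P_mat a \<alpha>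
      = lam \<alpha> \<cdot>\<^sub>m 1\<^sub>m (P_size a)"
    unfolding P_mat_def mat_diag_diag
    by (rule eq_matI) (auto simp: mat_diag_def dvd_div_mult_self[OF P_diagonal_dvd_lam])
qed (auto simp: diagonal_mat_def mat_diag_def)

lemma Pbar_mat_mult_P_mat: "Pbar_mat a \<alpha> * P_mat a \<alpha> = lam \<alpha> \<cdot>\<^sub>m 1\<^sub>m (P_size a)"
  unfolding Pbar_mat_eq P_mat_def mat_diag_diag
  by (rule eq_matI) (auto simp: mat_diag_def dvd_div_mult_self[OF P_diagonal_dvd_lam])

lemma P_mat_carrier [simp]: "P_mat a \<alpha> \<in> carrier_mat (P_size a) (P_size a)"
  by (simp add: P_mat_def)

lemma Pbar_mat_carrier [simp]: "Pbar_mat a \<alpha> \<in> carrier_mat (P_size a) (P_size a)"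
  by (simp add: Pbar_mat_eq)

lemma sigma_vec_sigma_inv_vec: "map_vec sigma (map_vec sigma_inv v) = v"
  by (rule eq_vecI) (simp_all add: sigma_inv_sigma)

text \<open>As \<open>sigma\<close> is a ring homomorphism undoing \<open>sigma_inv\<close>, the
  operator e f comes from the product of K^(-1), \<open>Pbar_mat\<close>, \<open>P_mat\<close> and
  K. The two middle factors form a scalar matrix, so K cancels.\<close>

lemma M_alpha_e_f:
  fixes K :: "complex poly mat" and \<alpha> :: complex
  assumes K: "K \<in> GL TYPE(complex poly) (P_size a)" and v: "v \<in> carrier_vec (P_size a)"
  defines "E \<equiv> map_mat sigma (inv\<^bsub>ring_mat TYPE(complex poly) (P_size a) ()\<^esub> K * Pbar_mat a \<alpha>)"
    and "F \<equiv> P_mat a \<alpha> * K"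
  shows "E *\<^sub>v map_vec sigma (F *\<^sub>v map_vec sigma_inv v) = sigma (lam \<alpha>) \<cdot>\<^sub>v v"
proof -
  define n where "n = P_size a"
  define L where "L = inv\<^bsub>ring_mat TYPE(complex poly) (P_size a) ()\<^esub> K"
  note L = GL_inv[OF K, folded L_def n_def]
  let ?w = "map_vec sigma_inv v" let ?P = "P_mat a \<alpha>" let ?Q = "Pbar_mat a \<alpha>"
  have P: "?P \<in> carrier_mat n n" and Q: "?Q \<in> carrier_mat n n"
    unfolding n_def by simp_all
  have w: "?w \<in> carrier_vec n" using v by (simp add: n_def)
  have F: "F \<in> carrier_mat n n" unfolding F_def using P L by simp
  have LQ: "L * ?Q \<in> carrier_mat n n" using L Q by simp
  have "(L * ?Q) * F = L * (?Q * ?P) * K"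
    unfolding F_def using L P Q by (simp add: assoc_mult_mat[of _ n n _ n _ n])
  also have "\<dots> = lam \<alpha> \<cdot>\<^sub>m 1\<^sub>m n"
    unfolding Pbar_mat_mult_P_mat n_def[symmetric] using L
    by (simp add: mult_smult_distrib[of _ n n _ n] mult_smult_assoc_mat[of _ n n _ n])
  finally have LQF: "(L * ?Q) * F = lam \<alpha> \<cdot>\<^sub>m 1\<^sub>m n" .
  have "E *\<^sub>v map_vec sigma (F *\<^sub>v ?w) = map_vec sigma (L * ?Q *\<^sub>v (F *\<^sub>v ?w))"
    unfolding E_def L_def[symmetric] using LQ F w
    by (subst sigma.mult_mat_vec_hom[of _ n n]) auto
  also have "L * ?Q *\<^sub>v (F *\<^sub>v ?w) = lam \<alpha> \<cdot>\<^sub>v ?w"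
    using LQ F w by (subst assoc_mult_mat_vec[symmetric, of _ n n _ n]) (auto simp: LQF)
  also have "map_vec sigma \<dots> = sigma (lam \<alpha>) \<cdot>\<^sub>v v"
    by (simp add: sigma.vec_hom_smult sigma_vec_sigma_inv_vec)
  finally show ?thesis .
qed

text \<open>A constant \<open>K\<close> is fixed by \<open>sigma\<close> and cancels its inverse
  inside \<open>E\<close>. In the coordinates \<open>K *\<^sub>v v\<close> the operator e is
  therefore diagonal up to \<open>sigma\<close>.\<close>

lemma M_alpha_K_e:
  fixes K :: "complex poly mat" and \<alpha> :: complex
  assumes K: "K \<in> GL TYPE(complex poly) (P_size a)" and v: "v \<in> carrier_vec (P_size a)"
    and K_const: "map_mat sigma K = K"
  defines "E \<equiv> map_mat sigma (inv\<^bsub>ring_mat TYPE(complex poly) (P_size a) ()\<^esub> K * Pbar_mat a \<alpha>)"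
  shows "K *\<^sub>v (E *\<^sub>v map_vec sigma v) = map_vec sigma (Pbar_mat a \<alpha> *\<^sub>v v)"
proof -
  define n where "n = P_size a"
  define L where "L = inv\<^bsub>ring_mat TYPE(complex poly) (P_size a) ()\<^esub> K"
  note L = GL_inv[OF K, folded L_def n_def]
  let ?Q = "Pbar_mat a \<alpha>"
  have Q: "?Q \<in> carrier_mat n n" and v: "v \<in> carrier_vec n"
    using v unfolding n_def by simp_all
  have LQ: "L * ?Q \<in> carrier_mat n n" using L Q by simp
  have "K *\<^sub>v (E *\<^sub>v map_vec sigma v) = map_mat sigma K *\<^sub>v map_vec sigma (L * ?Q *\<^sub>v v)"
    unfolding E_def L_def[symmetric] K_const using sigma.mult_mat_vec_hom[OF LQ v] by simp
  also have "\<dots> = map_vec sigma (K *\<^sub>v (L * ?Q *\<^sub>v v))"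
    by (rule sigma.mult_mat_vec_hom[OF L(4), symmetric]) (rule mult_mat_vec_carrier[OF LQ v])
  also have "K *\<^sub>v (L * ?Q *\<^sub>v v) = K * (L * ?Q) *\<^sub>v v"
    by (rule assoc_mult_mat_vec[OF L(4) LQ v, symmetric])
  also have "K * (L * ?Q) = ?Q"
    using assoc_mult_mat[OF L(4,1) Q] L(3) Q by simp
  finally show ?thesis .
qed

section \<open>The comparison map\<close>

lemma X_mult_monom: "[:0, 1:] * monom c n = monom (c :: 'a :: comm_semiring_1) (Suc n)"
  by (simp add: monom_Suc)

locale even_exponent =
  fixes m :: nat and a :: "nat \<Rightarrow> complex" and g :: "complex poly" and s :: nat
  assumes m: "m \<ge> 1"
    and g: "g = (\<Sum>j = 1..m. monom (a (2 * j)) (2 * j))"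
    and a: "a (2 * m) \<noteq> 0"
    and s: "s \<le> 1"
begin

sublocale h: linear_op "T3_h g" by (rule linear_T3_h)

text \<open>The basis b of the opening comment: dividing g' by 2t leaves j a_(2j) as the coefficient
  of t^(2j-2).\<close>

definition gen :: "nat \<Rightarrow> complex poly" where
  "gen i = (if i = 0 then \<Sum>j = 1..m. monom (of_nat j * a (2 * j)) (2 * (j - 1) + s)
    else monom 1 (2 * (i - 1) + s))"

text \<open>The C[h]-linear map that sends the standard basis of C[h]^m to
  \<open>gen\<close>.\<close>

definition Phi :: "complex poly vec \<Rightarrow> complex poly" where
  "Phi v = (\<Sum>i<m. op_poly (T3_h g) (v $ i) (gen i))"

text \<open>The sign of the middle entry selects the first diagonal entry of \<open>P_mat\<close>: h
  + 1/4 for s = 0 and h + 3/4 for s = 1. The complementary factor of \<open>lam\<close> becomes h -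
  s/2 - 1/4 under \<open>sigma\<close>, as multiplication of \<open>gen 0\<close> by t^2
  requires.\<close>

definition weight :: "nat \<times> int \<times> nat" where
  "weight = (0, if s = 0 then - 1 else 1, m - 1)"

lemma g_even: "g \<in> parity_polys 0"
  unfolding g by (induction m) (auto simp: parity_polys_def)

lemma degree_g: "degree g = 2 * m"
proof (rule antisym)
  show "degree g \<le> 2 * m"
    unfolding g by (intro degree_sum_le) (auto intro: order_trans[OF degree_monom_le])
  have "coeff g (2 * m) = a (2 * m)"
    using m unfolding g by (simp add: coeff_sum sum.delta)
  then show "2 * m \<le> degree g"
    using a by (intro le_degree) simp
qed

text \<open>The sum is t^k times t g' / 2. For k = s it equals t^2 \<open>gen 0\<close>, which links
  h to e.\<close>

lemma T3_h_monom: "T3_h g (monom 1 k) =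
  monom (of_nat k / 2 + 1/4) k + (\<Sum>j = 1..m. monom (of_nat j * a (2 * j)) (k + 2 * j))"
proof -
  have pderiv_sum: "pderiv (sum f A) = (\<Sum>j\<in>A. pderiv (f j))"
    and smult_sum: "Polynomial.smult c (sum f A) = (\<Sum>j\<in>A. Polynomial.smult c (f j))"
    for f :: "nat \<Rightarrow> complex poly" and A c
    by (induction A rule: infinite_finite_induct) (simp_all add: pderiv_add smult_add_right)
  have 1: "[:0, 1:] * pderiv (monom 1 k) = monom (of_nat k :: complex) k"
    by (cases k) (simp_all add: pderiv_monom X_mult_monom del: mult_pCons_left)
  have 2: "[:0, 1:] * (monom 1 k * pderiv g)
      = (\<Sum>j = 1..m. monom (2 * (of_nat j * a (2 * j))) (k + 2 * j))"
    by (simp add: g pderiv_sum pderiv_monom sum_distrib_left mult_monom X_mult_monom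
          del: mult_pCons_left)
      (intro sum.cong arg_cong2[of _ _ _ _ monom], auto)
  show ?thesis
    unfolding T3_h_def exp_pderiv_def distrib_left 1 2 smult_add_right smult_sum
    by (simp add: smult_monom add_monom[symmetric])
qed

text \<open>The summand t q g' / 2 has degree \<open>degree q + 2 * m\<close>, the others have
  degree at most \<open>degree q\<close>, and \<open>m \<ge> 1\<close> separates them.\<close>

lemma degree_T3_h:
  assumes "q \<noteq> 0"
  shows "degree (T3_h g q) = degree q + 2 * m"
proof -
  let ?r = "Polynomial.smult (1/2) ([:0, 1:] * pderiv q) + Polynomial.smult (1/4) q"
  let ?t = "Polynomial.smult (1/2) ([:0, 1:] * (q * pderiv g))"
  have "degree (pderiv g) = 2 * m - 1"
    by (simp add: degree_pderiv degree_g)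
  then have dg: "Suc (degree (pderiv g)) = 2 * m"
    using m by simp
  then have "pderiv g \<noteq> 0"
    using m by (auto simp: pderiv_eq_0_iff degree_g)
  then have t: "degree ?t = degree q + 2 * m"
    using assms dg by (simp add: degree_mult_eq del: mult_pCons_left)
  have "degree ([:0, 1:] * pderiv q) \<le> degree q"
  proof (cases "pderiv q = 0")
    case False
    then have "degree q \<noteq> 0" by (simp add: pderiv_eq_0_iff)
    then show ?thesis
      using False by (simp add: degree_mult_eq degree_pderiv del: mult_pCons_left)
  qed simp
  then have "degree ?r \<le> degree q"
    by (intro degree_add_le) (simp_all del: mult_pCons_left)
  then have "degree ?r < degree ?t"
    using m t by simp
  then have "degree (?r + ?t) = degree q + 2 * m"
    using t degree_add_eq_right by metis
  moreover have "T3_h g q = ?r + ?t"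
    by (simp add: T3_h_def exp_pderiv_def smult_add_right algebra_simps)
  ultimately show ?thesis by simp
qed

lemma gen_parity: "gen i \<in> parity_polys s"
proof -
  have "(\<Sum>j\<in>A. monom (c j) (2 * (j - 1) + s)) \<in> parity_polys s" for A and c :: "nat \<Rightarrow> complex"
    by (induction A rule: infinite_finite_induct)
      (auto intro!: parity_polys_subspace monom_parity_polys)
  then show ?thesis
    by (simp add: gen_def monom_parity_polys)
qed

text \<open>For i < m these degrees run exactly once through the numbers 2k + s with k < m, so they
  are distinct modulo 2m. The top place is taken by \<open>gen 0\<close>, whose leading coefficient
  m a_(2m) is nonzero.\<close>

lemma degree_gen: "gen i \<noteq> 0" "degree (gen i) = 2 * (if i = 0 then m - 1 else i - 1) + s"
proof -
  have c: "coeff (gen 0) (2 * (m - 1) + s) \<noteq> 0"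
  proof -
    have "coeff (gen 0) (2 * (m - 1) + s)
        = (\<Sum>j = 1..m. if j = m then of_nat j * a (2 * j) else 0)"
      by (subst gen_def, simp only: refl if_True coeff_sum coeff_monom, intro sum.cong) auto
    then show ?thesis using m a by simp
  qed
  moreover have "degree (gen 0) \<le> 2 * (m - 1) + s"
    unfolding gen_def by (auto intro!: degree_sum_le order_trans[OF degree_monom_le])
  ultimately have "degree (gen 0) = 2 * (m - 1) + s"
    by (intro antisym le_degree)
  then show "degree (gen i) = 2 * (if i = 0 then m - 1 else i - 1) + s"
    by (simp add: gen_def degree_monom_eq)
  show "gen i \<noteq> 0"
    using c by (cases "i = 0") (auto simp: gen_def)
qed

text \<open>The factor -1/2 in the monomial basis accounts for the entries -2 and for the factor -2
  in the first column.\<close>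

lemma gen_eq_K3:
  assumes "i < m"
  shows "gen i = (\<Sum>j<m. Polynomial.smult (K3 m a $$ (j, i)) (monom (-1/2) (2 * j + s)))"
proof (cases "i = 0")
  case True
  then show ?thesis
    using m by (simp add: gen_def K3_def sum.atLeast1_atMost_eq smult_monom)
      (intro sum.cong arg_cong2[of _ _ _ _ monom], simp_all add: field_simps)
next
  case False
  have "(\<Sum>j<m. Polynomial.smult (K3 m a $$ (j, i)) (monom (-1/2) (2 * j + s)))
      = (\<Sum>j<m. if j = i - 1 then monom 1 (2 * j + s) else 0)"
    using False assms by (intro sum.cong) (auto simp: K3_def smult_monom)
  then show ?thesis
    using False assms by (simp add: gen_def)
qed

text \<open>Change of basis by \<open>K3\<close>: its entries are scalars, so they pass through
  polynomials in h, and the two sums can be exchanged.\<close>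

lemma Phi_eq_K3:
  assumes "v \<in> carrier_vec m"
  shows "Phi v = (\<Sum>j<m. op_poly (T3_h g) ((const_mat (K3 m a) *\<^sub>v v) $ j) (monom (-1/2) (2 * j + s)))"
proof -
  have "(const_mat (K3 m a) *\<^sub>v v) $ j = (\<Sum>i<m. Polynomial.smult (K3 m a $$ (j, i)) (v $ i))"
    if "j < m" for j
    using that assms by (simp add: scalar_prod_def atLeast0LessThan K3_def)
  then have "(\<Sum>j<m. op_poly (T3_h g) ((const_mat (K3 m a) *\<^sub>v v) $ j) (monom (-1/2) (2 * j + s)))
     = (\<Sum>j<m. \<Sum>i<m. Polynomial.smult (K3 m a $$ (j, i)) (op_poly (T3_h g) (v $ i) (monom (-1/2) (2 * j + s))))"
    by (simp add: h.op_poly_sum h.op_poly_smult)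
  also have "\<dots> = (\<Sum>i<m. op_poly (T3_h g) (v $ i) (gen i))"
  proof (subst sum.swap, rule sum.cong)
    fix i assume "i \<in> {..<m}"
    interpret p: linear_op "op_poly (T3_h g) (v $ i)" by (rule h.linear_op_poly)
    show "(\<Sum>j<m. Polynomial.smult (K3 m a $$ (j, i)) (op_poly (T3_h g) (v $ i) (monom (-1/2) (2 * j + s))))
        = op_poly (T3_h g) (v $ i) (gen i)"
      using \<open>i \<in> {..<m}\<close> by (simp add: gen_eq_K3 p.sum p.smult)
  qed simp
  finally show ?thesis by (simp add: Phi_def)
qed

lemma P_size_weight [simp]: "P_size weight = m"
  using m by (simp add: weight_def P_size_def)

lemma sigma_Pbar_entry:
  assumes "i < m"
  shows "sigma (lam (1/4) div P_diagonal weight (1/4) ! i)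
    = (if i = 0 then [:of_nat s / 2 + 1/4, -1:] else - 1)"
proof -
  \<comment> \<open>The factors h - \<alpha> + 1 and h + \<alpha> at \<alpha> = 1/4.\<close>
  define p q :: "complex poly" where "p = [:3/4, 1:]" and "q = [:1/4, 1:]"
  have nz: "p \<noteq> 0" "q \<noteq> 0" and lam: "lam (1/4) = - (p * q)"
    by (simp_all add: p_def q_def lam_def)
  have "P_diagonal weight (1/4) ! i = (if i = 0 then if s = 0 then q else p else p * q)"
    using assms by (cases i) (simp_all add: P_diagonal_def weight_def p_def q_def)
  then have "lam (1/4) div P_diagonal weight (1/4) ! i
      = (if i = 0 then if s = 0 then - p else - q else - 1)"
    using nonzero_mult_div_cancel_left[of p "- q"] nonzero_mult_div_cancel_right[of q "- p"]
      nonzero_mult_div_cancel_right[of "p * q" "- 1"] nz by (simp add: lam)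
  moreover have "sigma (- p) = [:1/4, -1:]" "sigma (- q) = [:3/4, -1:]"
    by (simp_all add: p_def q_def sigma_pCons)
  ultimately show ?thesis
    using s by (cases "s = 0") (auto simp: le_Suc_eq sigma.hom_uminus)
qed

text \<open>From the basis \<open>gen\<close> to the scaled monomials, e is diagonal, with the
  entries of \<open>Pbar_mat\<close> after \<open>sigma\<close>.\<close>

lemma T3_e_gen:
  assumes "i < m"
  shows "T3_e (gen i) =
    op_poly (T3_h g) (sigma (lam (1/4) div P_diagonal weight (1/4) ! i)) (monom (-1/2) (2 * i + s))"
proof (cases "i = 0")
  case True
  have "T3_e (gen 0) = Polynomial.smult (1/2) (\<Sum>j = 1..m. monom (of_nat j * a (2 * j)) (s + 2 * j))"
    unfolding T3_e_def gen_def by (simp add: sum_distrib_left X_mult_monom del: mult_pCons_left)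
      (intro arg_cong[of _ _ "Polynomial.smult _"] sum.cong arg_cong2[of _ _ _ _ monom], auto)
  moreover have "op_poly (T3_h g) [:c, -1:] (Polynomial.smult (-1/2) q)
      = Polynomial.smult (1/2) (T3_h g q - Polynomial.smult c q)" for c q
    by (simp add: h.smult h.minus smult_diff_right)
  \<comment> \<open>With this constant the lowest term in \<open>T3_h_monom\<close> cancels and t^2
    \<open>gen 0\<close> remains.\<close>
  from this[of "of_nat s / 2 + 1/4" "monom 1 s"]
  have "op_poly (T3_h g) [:of_nat s / 2 + 1/4, -1:] (monom (-1/2) s)
      = Polynomial.smult (1/2) (\<Sum>j = 1..m. monom (of_nat j * a (2 * j)) (s + 2 * j))"
    by (simp only: T3_h_monom smult_monom) simp
  ultimately show ?thesis
    using True unfolding sigma_Pbar_entry[OF assms] by simp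
next
  case False
  have "op_poly (T3_h g) (- 1) q = - q" for q
    using h.op_poly_pCons[of "- 1" 0 q] by (simp add: one_pCons)
  moreover obtain k where "i = Suc k" using False by (cases i) auto
  ultimately show ?thesis
    unfolding sigma_Pbar_entry[OF assms]
    by (simp add: T3_e_def gen_def X_mult_monom smult_monom minus_monom del: mult_pCons_left)
qed

section \<open>Equivariance of the comparison map\<close>

abbreviation M :: "complex poly vec sl2_mod" where
  "M \<equiv> sl2_M_alpha (1/4) weight (const_mat (K3 m a))"

definition E where "E = map_mat sigma
  (inv\<^bsub>ring_mat TYPE(complex poly) m ()\<^esub> (const_mat (K3 m a)) * Pbar_mat weight (1/4))"

definition F where "F = P_mat weight (1/4) * const_mat (K3 m a)"

lemma M_eq: "M = sl2_M m E F"
  by (simp add: sl2_M_alpha_def E_def F_def)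

lemma K_GL: "const_mat (K3 m a) \<in> GL TYPE(complex poly) (P_size weight)"
  using const_mat_GL[OF K3_GL[of m a, OF m a]] by simp

lemma EF_carrier: "E \<in> carrier_mat m m" "F \<in> carrier_mat m m"
  using GL_inv(1)[OF K_GL] Pbar_mat_carrier[of weight] P_mat_carrier[of weight]
  by (auto simp: E_def F_def intro!: mult_carrier_mat[of _ m m])

lemma Phi_add:
  assumes "v \<in> carrier_vec m" "w \<in> carrier_vec m"
  shows "Phi (v + w) = Phi v + Phi w"
  using assms by (simp add: Phi_def h.op_poly_add sum.distrib)

lemma Phi_smult:
  assumes "v \<in> carrier_vec m"
  shows "Phi (p \<cdot>\<^sub>v v) = op_poly (T3_h g) p (Phi v)"
proof -
  interpret p: linear_op "op_poly (T3_h g) p" by (rule h.linear_op_poly)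
  show ?thesis using assms by (simp add: Phi_def h.op_poly_mult p.sum)
qed

lemma Phi_parity: "Phi v \<in> parity_polys s"
proof -
  have "op_poly (T3_h g) p (gen i) \<in> parity_polys s" for p i
    by (induction p)
      (auto intro!: parity_polys_subspace gen_parity parity_polys_act_T3(1)[OF g_even])
  then have "(\<Sum>i\<in>A. op_poly (T3_h g) (v $ i) (gen i)) \<in> parity_polys s" for A
    by (induction A rule: infinite_finite_induct) (auto intro!: parity_polys_subspace)
  then show ?thesis by (simp add: Phi_def)
qed

text \<open>Multiplying the coordinates by \<open>K3\<close> makes e diagonal,
  \<open>T3_e_gen\<close> trades each diagonal entry for an application of e, and
  \<open>op_poly_shift\<close> moves e outside.\<close>

lemma Phi_e:
  assumes v: "v \<in> carrier_vec m"
  shows "Phi (E *\<^sub>v map_vec sigma v) = T3_e (Phi v)"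
proof -
  interpret e: linear_op T3_e by (rule linear_T3_e)
  let ?d = "\<lambda>i. lam (1/4) div P_diagonal weight (1/4) ! i"
  have K: "map_mat sigma (const_mat (K3 m a)) = const_mat (K3 m a)"
    by (rule eq_matI) simp_all
  have Pbar: "(Pbar_mat weight (1/4) *\<^sub>v v) $ i = ?d i * v $ i" if "i < m" for i
  proof -
    have "(Pbar_mat weight (1/4) *\<^sub>v v) $ i = (\<Sum>j<m. if i = j then ?d i * v $ i else 0)"
      using that v unfolding Pbar_mat_eq
      by (simp add: mat_diag_def scalar_prod_def atLeast0LessThan
        if_distrib[where f = "\<lambda>x. x * z" for z] cong: if_cong)
    then show ?thesis using that by simp
  qed
  have "Phi (E *\<^sub>v map_vec sigma v) = (\<Sum>i<m. op_poly (T3_h g)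
      ((const_mat (K3 m a) *\<^sub>v (E *\<^sub>v map_vec sigma v)) $ i) (monom (-1/2) (2 * i + s)))"
    using v EF_carrier by (intro Phi_eq_K3) (auto intro!: mult_mat_vec_carrier[of _ m m])
  also have "const_mat (K3 m a) *\<^sub>v (E *\<^sub>v map_vec sigma v)
      = map_vec sigma (Pbar_mat weight (1/4) *\<^sub>v v)"
    using M_alpha_K_e[OF K_GL _ K, of v "1/4"] v by (simp add: E_def)
  also have "(\<Sum>i<m. op_poly (T3_h g) (map_vec sigma (Pbar_mat weight (1/4) *\<^sub>v v) $ i)
        (monom (-1/2) (2 * i + s)))
      = (\<Sum>i<m. op_poly (T3_h g) (sigma (v $ i)) (T3_e (gen i)))"
  proof (rule sum.cong)
    fix i assume "i \<in> {..<m}"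
    then have i: "i < m" by simp
    \<comment> \<open>The factors are ordered so that the diagonal entry acts on the monomial first,
      as in \<open>T3_e_gen\<close>.\<close>
    then have "map_vec sigma (Pbar_mat weight (1/4) *\<^sub>v v) $ i = sigma (v $ i) * sigma (?d i)"
      using Pbar[OF i] carrier_matD[OF Pbar_mat_carrier[of weight "1/4"]]
      by (simp add: sigma.hom_mult mult.commute)
    then show "op_poly (T3_h g) (map_vec sigma (Pbar_mat weight (1/4) *\<^sub>v v) $ i)
        (monom (-1/2) (2 * i + s)) = op_poly (T3_h g) (sigma (v $ i)) (T3_e (gen i))"
      by (simp only: h.op_poly_mult T3_e_gen[OF i])
  qed simp
  also have "\<dots> = T3_e (Phi v)"
    unfolding Phi_def e.sum
    by (intro sum.cong refl h.op_poly_shift[OF linear_T3_e, symmetric]) (simp add: T3_h_e)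
  finally show ?thesis .
qed

lemma Phi_f:
  assumes v: "v \<in> carrier_vec m"
  shows "Phi (F *\<^sub>v map_vec sigma_inv v) = T3_f g (Phi v)"
proof (rule T3_e_inj)
  have w: "F *\<^sub>v map_vec sigma_inv v \<in> carrier_vec m"
    using v EF_carrier by (auto intro!: mult_mat_vec_carrier[of _ m m])
  have "T3_e (Phi (F *\<^sub>v map_vec sigma_inv v))
      = Phi (E *\<^sub>v map_vec sigma (F *\<^sub>v map_vec sigma_inv v))"
    by (rule Phi_e[OF w, symmetric])
  \<comment> \<open>On both sides e f is the same polynomial in h, and \<open>Phi\<close> respects
    polynomials in h.\<close>
  also have "\<dots> = Phi (sigma (lam (1/4)) \<cdot>\<^sub>v v)"
    using M_alpha_e_f[OF K_GL, of v "1/4"] v by (simp add: E_def F_def)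
  also have "\<dots> = T3_e (T3_f g (Phi v))"
    by (simp add: Phi_smult[OF v] op_poly_sigma_lam)
  finally show "T3_e (Phi (F *\<^sub>v map_vec sigma_inv v)) = T3_e (T3_f g (Phi v))" .
qed

lemma Phi_act:
  assumes v: "v \<in> carrier_vec m"
  shows "Phi (act M u v) = act (T3 g) u (Phi v)" "act M u v \<in> carrier_vec m"
proof -
  obtain x y z where u: "u = (x, y, z)" by (metis prod_cases3)
  have c: "E *\<^sub>v map_vec sigma v \<in> carrier_vec m" "F *\<^sub>v map_vec sigma_inv v \<in> carrier_vec m"
    using v EF_carrier by (auto intro!: mult_mat_vec_carrier[of _ m m])
  show "act M u v \<in> carrier_vec m"
    unfolding M_eq u act_sl2_M using c v by simp
  show "Phi (act M u v) = act (T3 g) u (Phi v)"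
    unfolding M_eq u act_sl2_M act_T3
    using c v by (simp add: Phi_add Phi_smult Phi_e Phi_f del: smult_smult_assoc)
qed

section \<open>Bijectivity of the comparison map\<close>

lemma Phi_eq_0:
  assumes v: "v \<in> carrier_vec m" and "Phi v = 0"
  shows "v = 0\<^sub>v m"
proof (rule ccontr)
  assume "v \<noteq> 0\<^sub>v m"
  then obtain k where k: "k < m" "v $ k \<noteq> 0"
    using v by (metis carrier_vecD eq_vecI index_zero_vec)
  define p where "p i = op_poly (T3_h g) (v $ i) (gen i)" for i
  define d where "d i = 2 * (if i = 0 then m - 1 else i - 1) + s" for i
  have p: "p i \<noteq> 0" "degree (p i) = d i + degree (v $ i) * (2 * m)" if "v $ i \<noteq> 0" for i
    using h.op_poly_degree[OF degree_T3_h _ that degree_gen(1)[of i]] m degree_gen(2)[of i]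
    by (simp_all add: p_def d_def)
  have v_nz: "v $ i \<noteq> 0" if "p i \<noteq> 0" for i
    using that by (auto simp: p_def)
  have "sum p {..<m} \<noteq> 0"
  proof (rule sum_distinct_degrees_nonzero)
    show "k \<in> {..<m}" "p k \<noteq> 0" using k p by auto
    fix i j assume ij: "i \<in> {..<m}" "j \<in> {..<m}" "p i \<noteq> 0" "p j \<noteq> 0"
      and deg: "degree (p i) = degree (p j)"
    \<comment> \<open>The degree of \<open>gen i\<close> is thus the remainder of
      \<open>degree (p i)\<close> modulo \<open>2 * m\<close>, and it determines
      \<open>i\<close>.\<close>
    have "d i < 2 * m" "d j < 2 * m"
      using ij s by (auto simp: d_def)
    then have "d i = degree (p i) mod (2 * m)" "d j = degree (p j) mod (2 * m)"
      using p(2)[OF v_nz[OF ij(3)]] p(2)[OF v_nz[OF ij(4)]] by simp_all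
    then have "d i = d j" using deg by simp
    then show "i = j" using ij by (auto simp: d_def split: if_splits)
  qed simp
  then show False using assms by (simp add: Phi_def p_def)
qed

lemma Phi_inj: "inj_on Phi (carrier_vec m)"
proof (rule inj_onI)
  fix v w assume vw: "v \<in> carrier_vec m" "w \<in> carrier_vec m" "Phi v = Phi w"
  have "Phi (v + [:-1:] \<cdot>\<^sub>v w) = 0"
    using vw by (simp add: Phi_add Phi_smult)
  then have "v + [:-1:] \<cdot>\<^sub>v w = 0\<^sub>v m"
    using vw by (intro Phi_eq_0) simp_all
  then have "v $ i - w $ i = 0" if "i < m" for i
    using that vw by (metis index_add_vec(1) index_smult_vec carrier_vecD index_zero_vec(1)
        add_uminus_conv_diff mult_minus1 one_pCons minus_pCons minus_zero)
  then show "v = w"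
    using vw by (intro eq_vecI) auto
qed

lemma Phi_unit_vec: "i < m \<Longrightarrow> Phi (unit_vec m i) = gen i"
proof -
  assume "i < m"
  then have "Phi (unit_vec m i) = (\<Sum>j<m. if j = i then gen i else 0)"
    unfolding Phi_def by (intro sum.cong) (auto simp: unit_vec_def one_pCons)
  then show ?thesis using \<open>i < m\<close> by simp
qed

text \<open>The image is stable under h. By strong induction on k it contains each t^(2k+s): as a
  generator, as the top term of \<open>gen 0\<close>, or as the top term of h applied to
  t^(2(k-m)+s).\<close>

lemma Phi_surj: "parity_polys s \<subseteq> Phi ` carrier_vec m"
proof -
  let ?U = "Phi ` carrier_vec m"
  have add: "p + q \<in> ?U" if "p \<in> ?U" "q \<in> ?U" for p q
    using that by (auto simp: Phi_add[symmetric])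
  have op: "op_poly (T3_h g) r p \<in> ?U" if "p \<in> ?U" for r p
    using that by (auto simp: Phi_smult[symmetric])
  have smult: "Polynomial.smult c p \<in> ?U" if "p \<in> ?U" for c p
    using op[OF that, of "[:c:]"] by simp
  have zero: "0 \<in> ?U"
    using smult[OF imageI[OF zero_carrier_vec], of 0] by simp
  \<comment> \<open>Isolates the top term of an expansion: all other terms already lie in the image,
    and the coefficient m a_(2m) can be divided out. Here \<open>N j\<close> is the exponent of
    summand \<open>j\<close>.\<close>
  have top: "monom 1 n \<in> ?U"
    if p: "p \<in> ?U" and expand: "p = q + (\<Sum>j = 1..m. monom (of_nat j * a (2 * j)) (N j))"
      and q: "q \<in> ?U" and N: "N m = n" and lower: "\<And>j. \<lbrakk>1 \<le> j; j < m\<rbrakk> \<Longrightarrow> monom 1 (N j) \<in> ?U"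
    for p q n and N :: "nat \<Rightarrow> nat"
  proof -
    let ?c = "of_nat m * a (2 * m)"
    have "monom (of_nat j * a (2 * j)) (N j) \<in> ?U" if "1 \<le> j" "j < m" for j
      using smult[OF lower[OF that], of "of_nat j * a (2 * j)"] by (simp add: smult_monom)
    then have "(\<Sum>j\<in>A. monom (of_nat j * a (2 * j)) (N j)) \<in> ?U" if "A \<subseteq> {1..<m}" for A
      using that by (induction A rule: infinite_finite_induct) (auto intro: zero add)
    from this[OF subset_refl] smult[of _ "-1"]
    have "p + (Polynomial.smult (-1) q
        + Polynomial.smult (-1) (\<Sum>j = 1..<m. monom (of_nat j * a (2 * j)) (N j))) \<in> ?U"
      using p q by (intro add) blast+
    moreover have "(\<Sum>j = 1..m. monom (of_nat j * a (2 * j)) (N j))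
        = (\<Sum>j = 1..<m. monom (of_nat j * a (2 * j)) (N j)) + monom ?c n"
      using m N by (simp add: sum.last_plus atLeastLessThanSuc_atLeastAtMost[symmetric] del: sum.op_ivl_Suc)
        (simp add: add.commute)
    ultimately have "monom ?c n \<in> ?U"
      using expand by simp
    from smult[OF this, of "1 / ?c"] show ?thesis
      using m a by (simp add: smult_monom)
  qed
  have monom: "monom 1 (2 * k + s) \<in> ?U" for k
  proof (induction k rule: less_induct)
    case (less k)
    consider "k < m - 1" | "k = m - 1" | "k \<ge> m" by linarith
    then show ?case
    proof cases
      case 1
      then have "Phi (unit_vec m (Suc k)) = monom 1 (2 * k + s)"
        by (subst Phi_unit_vec) (auto simp: gen_def)
      then show ?thesis using imageI[OF unit_vec_carrier, of Phi m "Suc k"] by simp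
    next
      case 2
      \<comment> \<open>The exponent 2(m-1) + s is missing among the monomial generators;
        \<open>gen 0\<close> supplies it.\<close>
      have "gen 0 = Phi (unit_vec m 0)" using m by (simp add: Phi_unit_vec)
      then have "gen 0 \<in> ?U" using imageI[OF unit_vec_carrier] by simp
      then show ?thesis
      proof (rule top)
        show "gen 0 = 0 + (\<Sum>j = 1..m. monom (of_nat j * a (2 * j)) (2 * (j - 1) + s))"
          by (simp add: gen_def)
        show "2 * (m - 1) + s = 2 * k + s" using 2 by simp
        show "monom 1 (2 * (j - 1) + s) \<in> ?U" if "1 \<le> j" "j < m" for j
          using less[of "j - 1"] that 2 by simp
      qed (rule zero)
    next
      case 3
      let ?k = "2 * (k - m) + s"
      have k: "monom 1 ?k \<in> ?U" using less[of "k - m"] 3 m by simp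
      have "T3_h g (monom 1 ?k) \<in> ?U"
        using op[OF k, of "[:0, 1:]"] by simp
      then show ?thesis
      proof (rule top[OF _ T3_h_monom])
        show "monom (of_nat ?k / 2 + 1/4) ?k \<in> ?U"
          using smult[OF k, of "of_nat ?k / 2 + 1/4"] by (simp add: smult_monom)
        show "?k + 2 * m = 2 * k + s" using 3 by simp
        show "monom 1 (?k + 2 * j) \<in> ?U" if "j < m" for j
        proof -
          have "k - m + j < k" "2 * (k - m + j) + s = ?k + 2 * j" using that 3 by simp_all
          then show ?thesis using less[of "k - m + j"] by (simp add: add_ac)
        qed
      qed
    qed
  qed
  show ?thesis
    by (rule parity_polys_induct) (fact zero, fact add, fact smult, fact monom, rule s)
qed

lemma T3_parity_isomorphic:
  "sl2_isomorphic ((T3 g)\<lparr>carrier := parity_polys s\<rparr>) M"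
proof -
  let ?T = "(T3 g)\<lparr>carrier := parity_polys s\<rparr>"
  have T: "sl2_module ?T"
    by (rule sl2_submodule_imp_module[OF parity_polys_submodule[OF g_even]])
  interpret T: sl2_module ?T by (rule T)
  interpret M: vectorspace "class_ring :: complex ring" M
    unfolding M_eq by (rule sl2_M_vectorspace)
  have M: "carrier M = carrier_vec m" "add M = (+)"
    "module.smult M = (\<lambda>c v. [:c:] \<cdot>\<^sub>v v)"
    by (simp_all add: M_eq)
  have "Phi \<in> LinearCombinations.module_hom (class_ring :: complex ring) M ?T"
    unfolding LinearCombinations.module_hom_def M by (simp add: Phi_parity Phi_add Phi_smult)
  then have "linear_map (class_ring :: complex ring) M ?T Phi"
    by unfold_locales
  moreover have "bij_betw Phi (carrier M) (carrier ?T)"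
    unfolding bij_betw_def M using Phi_inj Phi_surj Phi_parity by auto
  ultimately show ?thesis
    by (rule sl2_isomorphic_inverseI[OF T]) (simp_all add: M Phi_act)
qed

end

theorem proposition6p11:
  fixes m :: nat and a :: "nat \<Rightarrow> complex" and g :: "complex poly"
  assumes "m \<ge> 1"
    and "g = (\<Sum>j = 1..m. monom (a (2 * j)) (2 * j))"
    and "a (2 * m) \<noteq> 0"
  shows "sl2_direct_sum (T3 g) (carrier (T3_ev g)) (carrier (T3_odd g))
    \<and> K3 m a \<in> GL TYPE(complex) m
    \<and> sl2_isomorphic (T3_ev g) (sl2_M_alpha (1/4) (0, -1, m - 1) (const_mat (K3 m a)))
    \<and> sl2_isomorphic (T3_odd g) (sl2_M_alpha (1/4) (0, 1, m - 1) (const_mat (K3 m a)))"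
proof -
  \<comment> \<open>The even and odd parts are the instances s = 0 and s = 1.\<close>
  interpret ev: even_exponent m a g 0 by unfold_locales (use assms in auto)
  interpret od: even_exponent m a g 1 by unfold_locales (use assms in auto)
  have "T3_ev g = (T3 g)\<lparr>carrier := parity_polys 0\<rparr>" "T3_odd g = (T3 g)\<lparr>carrier := parity_polys 1\<rparr>"
    by (simp_all add: T3_ev_def T3_odd_def poly_even_eq poly_odd_eq)
  moreover have "ev.weight = (0, - 1, m - 1)" "od.weight = (0, 1, m - 1)"
    by (subst ev.weight_def od.weight_def; simp)+
  ultimately show ?thesis
    using T3_direct_sum[OF ev.g_even] K3_GL[of m a, OF assms(1,3)]
      ev.T3_parity_isomorphic od.T3_parity_isomorphic
    by (simp del: One_nat_def)
qed

end
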